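(* Let $Q$ be a commutative involutive zero-divisor-free quantale, $X$ a set, and $\mathbf{A}$ an object of $\mathbf{Rel}_Q\text{-}\mathbf{Alg}_{\mathrm{vN}}(X)$ with decomposition $\mathbf{A}=\prod_i e_i\mathbf{A}$ into indecomposable components, where the $e_i$ are the primitive subunital idempotents of $\mathbf{A}$. Then for each index $a$, the complement $\overline{e_a\mathbf{A}}=\prod_{i\neq a} e_i\mathbf{A}$ (the set of elements of $\mathbf{A}$ whose $e_a$-component is zero) is a prime ideal of $\mathbf{A}$.
   Context: A commutative involutive quantale $Q$ is a complete join-semilattice with a commutative monoid operation $\cdot$ (unit $1_Q$) distributing over arbitrary joins, and a join-preserving involution ${}^*$ with $(xy)^*=y^*x^*$, $1_Q^*=1_Q$; $0$ denotes its least element ($0\ne\top$). ZDF means $xy=0\Rightarrow x=0$ or $y=0$. In $\mathbf{Rel}_Q$, objects are sets, morphisms $X\to Y$ are functions $X\times Y\to Q$, with composition $(g\circ f)(x,z)=\bigvee_y f(x,y)\cdot g(y,z)$, identities the diagonal with $1_Q$ on the diagonal and $0$ elsewhere, and dagger $f^\dagger(y,x)=f(x,y)^*$. $\mathrm{Hom}(X,X)$ is a $Q$-semialgebra (addition = pointwise join, multiplication = composition, scalar multiplication pointwise, involution $\dagger$). Objects of $\mathbf{Rel}_Q\text{-}\mathbf{Alg}_{\mathrm{vN}}(X)$ are subsets $\mathbf{A}\subseteq\mathrm{Hom}(X,X)$ containing $0,\mathrm{id}_X$, closed under binary joins, composition, scalar multiplication and $\dagger$, commutative, and equal to their double commutant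 $\mathbf{A}''$ (where $B'=\{f:fg=gf\ \forall g\in B\}$). A subunital idempotent of $\mathbf{A}$ is an idempotent $p$ with an idempotent $q$, $p\circ q=0$, $p+q=\mathrm{id}_X$; it is primitive if it is not a sum of two non-trivial subunital idempotents. For such $\mathbf{A}$ (with $Q$ ZDF) the primitive subunital idempotents $e_i$ satisfy $\mathbf{A}\cong\prod_i e_i\mathbf{A}$ via $f\mapsto(e_i\circ f)_i$, where $e_i\mathbf{A}=\{e_i\circ f:f\in\mathbf{A}\}$. An ideal of the commutative semiring $\mathbf{A}$ is a subset containing $0$, closed under addition and under multiplication by arbitrary elements of $\mathbf{A}$; it is prime if $st\in J$ implies $s\in J$ or $t\in J$. *)

theory Defs
  imports Main "HOL-Library.FuncSet"
begin

(* The least element 0 of the quantale is bot; join-semilattices with arbitrary joins are the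
   complete lattices. *)
class comm_involutive_quantale = complete_lattice + comm_monoid_mult +
  fixes involution :: "'a \<Rightarrow> 'a"
  assumes mult_Sup: "x * Sup S = (SUP s\<in>S. x * s)"
    and involution_Sup: "involution (Sup S) = (SUP s\<in>S. involution s)"
    and involution_mult: "involution (x * y) = involution y * involution x"
    and involution_one: "involution 1 = 1"
    and involution_involution: "involution (involution x) = x"
    and bot_neq_top: "bot \<noteq> top"

definition zero_divisor_free :: "'q::comm_involutive_quantale itself \<Rightarrow> bool" where
  "zero_divisor_free _ \<longleftrightarrow> (\<forall>x y :: 'q. x * y = bot \<longrightarrow> x = bot \<or> y = bot)"

text \<open>Morphisms \<open>X \<rightarrow> Y\<close> are extensional functions on \<open>X \<times> Y\<close>, so that equality of morphisms is
  equality of terms also when \<open>X\<close> and \<open>Y\<close> are proper (possibly empty) subsets of their types.\<close>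

definition Hom :: "'x set \<Rightarrow> 'y set \<Rightarrow> ('x \<times> 'y \<Rightarrow> 'q::comm_involutive_quantale) set" where
  "Hom X Y = X \<times> Y \<rightarrow>\<^sub>E UNIV"

(* rel_comp X Y Z g f is "g after f" for f in Hom X Y and g in Hom Y Z. *)
definition rel_comp :: "'x set \<Rightarrow> 'y set \<Rightarrow> 'z set \<Rightarrow> ('y \<times> 'z \<Rightarrow> 'q::comm_involutive_quantale)
    \<Rightarrow> ('x \<times> 'y \<Rightarrow> 'q) \<Rightarrow> 'x \<times> 'z \<Rightarrow> 'q" where
  "rel_comp X Y Z g f = (\<lambda>(x, z)\<in>X \<times> Z. SUP y\<in>Y. f (x, y) * g (y, z))"

definition rel_id :: "'x set \<Rightarrow> 'x \<times> 'x \<Rightarrow> 'q::comm_involutive_quantale" where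
  "rel_id X = (\<lambda>(x, y)\<in>X \<times> X. if x = y then 1 else bot)"

definition rel_dagger :: "'x set \<Rightarrow> 'y set \<Rightarrow> ('x \<times> 'y \<Rightarrow> 'q::comm_involutive_quantale)
    \<Rightarrow> 'y \<times> 'x \<Rightarrow> 'q" where
  "rel_dagger X Y f = (\<lambda>(y, x)\<in>Y \<times> X. involution (f (x, y)))"

definition rel_zero :: "'x set \<Rightarrow> 'y set \<Rightarrow> 'x \<times> 'y \<Rightarrow> 'q::comm_involutive_quantale" where
  "rel_zero X Y = (\<lambda>_\<in>X \<times> Y. bot)"

definition rel_add :: "'x set \<Rightarrow> 'y set \<Rightarrow> ('x \<times> 'y \<Rightarrow> 'q::comm_involutive_quantale)
    \<Rightarrow> ('x \<times> 'y \<Rightarrow> 'q) \<Rightarrow> 'x \<times> 'y \<Rightarrow> 'q" where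
  "rel_add X Y f g = (\<lambda>z\<in>X \<times> Y. sup (f z) (g z))"

definition rel_scale :: "'x set \<Rightarrow> 'y set \<Rightarrow> 'q::comm_involutive_quantale
    \<Rightarrow> ('x \<times> 'y \<Rightarrow> 'q) \<Rightarrow> 'x \<times> 'y \<Rightarrow> 'q" where
  "rel_scale X Y s f = (\<lambda>z\<in>X \<times> Y. s * f z)"

abbreviation endo_comp ("(_ \<circ>\<^bsub>_\<^esub> _)" [76, 0, 75] 75) where
  "g \<circ>\<^bsub>X\<^esub> f \<equiv> rel_comp X X X g f"

abbreviation endo_add ("(_ +\<^bsub>_\<^esub> _)" [65, 0, 66] 65) where
  "f +\<^bsub>X\<^esub> g \<equiv> rel_add X X f g"

abbreviation endo_zero ("\<zero>\<^bsub>_\<^esub>") where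
  "\<zero>\<^bsub>X\<^esub> \<equiv> rel_zero X X"

definition commutant :: "'x set \<Rightarrow> ('x \<times> 'x \<Rightarrow> 'q::comm_involutive_quantale) set
    \<Rightarrow> ('x \<times> 'x \<Rightarrow> 'q) set" where
  "commutant X B = {f \<in> Hom X X. \<forall>g\<in>B. f \<circ>\<^bsub>X\<^esub> g = g \<circ>\<^bsub>X\<^esub> f}"

definition comm_vN_algebra :: "'x set \<Rightarrow> ('x \<times> 'x \<Rightarrow> 'q::comm_involutive_quantale) set \<Rightarrow> bool" where
  "comm_vN_algebra X A \<longleftrightarrow>
     A \<subseteq> Hom X X \<and> \<zero>\<^bsub>X\<^esub> \<in> A \<and> rel_id X \<in> A \<and>
     (\<forall>f\<in>A. \<forall>g\<in>A. f +\<^bsub>X\<^esub> g \<in> A) \<and>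
     (\<forall>f\<in>A. \<forall>g\<in>A. g \<circ>\<^bsub>X\<^esub> f \<in> A) \<and>
     (\<forall>s. \<forall>f\<in>A. rel_scale X X s f \<in> A) \<and>
     (\<forall>f\<in>A. rel_dagger X X f \<in> A) \<and>
     (\<forall>f\<in>A. \<forall>g\<in>A. f \<circ>\<^bsub>X\<^esub> g = g \<circ>\<^bsub>X\<^esub> f) \<and>
     A = commutant X (commutant X A)"

definition subunital_idempotents :: "'x set \<Rightarrow> ('x \<times> 'x \<Rightarrow> 'q::comm_involutive_quantale) set
    \<Rightarrow> ('x \<times> 'x \<Rightarrow> 'q) set" where
  "subunital_idempotents X A =
     {p \<in> A. p \<circ>\<^bsub>X\<^esub> p = p \<and>
        (\<exists>q\<in>A. q \<circ>\<^bsub>X\<^esub> q = q \<and> p \<circ>\<^bsub>X\<^esub> q = \<zero>\<^bsub>X\<^esub> \<and> p +\<^bsub>X\<^esub> q = rel_id X)}"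

text \<open>Addition is idempotent, so every \<open>p\<close> is the sum \<open>p + p\<close>, besides \<open>p + 0\<close>; a summand of \<open>p\<close> is
  therefore non-trivial when it is neither \<open>0\<close> nor \<open>p\<close>. By this definition \<open>0\<close> counts as primitive;
  it only contributes a factor \<open>{0}\<close> to the decomposition.\<close>

definition primitive_idempotents :: "'x set \<Rightarrow> ('x \<times> 'x \<Rightarrow> 'q::comm_involutive_quantale) set
    \<Rightarrow> ('x \<times> 'x \<Rightarrow> 'q) set" where
  "primitive_idempotents X A =
     {p \<in> subunital_idempotents X A.
        \<not> (\<exists>q\<in>subunital_idempotents X A. \<exists>r\<in>subunital_idempotents X A.
             q \<notin> {\<zero>\<^bsub>X\<^esub>, p} \<and> r \<notin> {\<zero>\<^bsub>X\<^esub>, p} \<and> p = q +\<^bsub>X\<^esub> r)}"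

definition component :: "'x set \<Rightarrow> ('x \<times> 'x \<Rightarrow> 'q::comm_involutive_quantale)
    \<Rightarrow> ('x \<times> 'x \<Rightarrow> 'q) set \<Rightarrow> ('x \<times> 'x \<Rightarrow> 'q) set" where
  "component X e A = (\<lambda>f. e \<circ>\<^bsub>X\<^esub> f) ` A"

definition decomposition :: "'x set \<Rightarrow> 'i set \<Rightarrow> ('i \<Rightarrow> 'x \<times> 'x \<Rightarrow> 'q::comm_involutive_quantale)
    \<Rightarrow> ('x \<times> 'x \<Rightarrow> 'q) \<Rightarrow> 'i \<Rightarrow> 'x \<times> 'x \<Rightarrow> 'q" where
  "decomposition X I e f = (\<lambda>i\<in>I. e i \<circ>\<^bsub>X\<^esub> f)"

text \<open>The product of the components \<open>e\<^sub>i A\<close> with \<open>i \<noteq> a\<close>, as a subset of \<open>A\<close>: it is embedded into the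
  product over all of \<open>I\<close> by \<open>0\<close> at \<open>a\<close>, and pulled back along the decomposition map.\<close>

definition component_complement :: "'x set \<Rightarrow> 'i set
    \<Rightarrow> ('i \<Rightarrow> 'x \<times> 'x \<Rightarrow> 'q::comm_involutive_quantale)
    \<Rightarrow> ('x \<times> 'x \<Rightarrow> 'q) set \<Rightarrow> 'i \<Rightarrow> ('x \<times> 'x \<Rightarrow> 'q) set" where
  "component_complement X I e A a =
     {f \<in> A. decomposition X I e f
        \<in> (\<Pi>\<^sub>E i\<in>I. if i = a then {\<zero>\<^bsub>X\<^esub>} else component X (e i) A)}"

lemma component_complement_eq:
  assumes "a \<in> I"
  shows "component_complement X I e A a = {f \<in> A. e a \<circ>\<^bsub>X\<^esub> f = \<zero>\<^bsub>X\<^esub>}"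
  using assms
  by (auto simp: component_complement_def decomposition_def component_def PiE_iff)

definition is_ideal :: "'x set \<Rightarrow> ('x \<times> 'x \<Rightarrow> 'q::comm_involutive_quantale) set
    \<Rightarrow> ('x \<times> 'x \<Rightarrow> 'q) set \<Rightarrow> bool" where
  "is_ideal X A J \<longleftrightarrow>
     J \<subseteq> A \<and> \<zero>\<^bsub>X\<^esub> \<in> J \<and>
     (\<forall>s\<in>J. \<forall>t\<in>J. s +\<^bsub>X\<^esub> t \<in> J) \<and>
     (\<forall>s\<in>A. \<forall>t\<in>J. s \<circ>\<^bsub>X\<^esub> t \<in> J)"

definition is_prime_ideal :: "'x set \<Rightarrow> ('x \<times> 'x \<Rightarrow> 'q::comm_involutive_quantale) set
    \<Rightarrow> ('x \<times> 'x \<Rightarrow> 'q) set \<Rightarrow> bool" where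
  "is_prime_ideal X A J \<longleftrightarrow>
     is_ideal X A J \<and> (\<forall>s\<in>A. \<forall>t\<in>A. s \<circ>\<^bsub>X\<^esub> t \<in> J \<longrightarrow> s \<in> J \<or> t \<in> J)"

end

(* Zero-divisor-freeness forces every subunital idempotent to be the indicator of a subset of the
   diagonal. Call x, y in X related when some g in the commutant A' has g (x, y) different from
   bot. This is an equivalence relation, and since A = A'', the indicators in A are exactly those
   of saturated subsets, so a primitive idempotent is the indicator of (at most) one class C.
   If s (x, y) and t (u, v) are nonzero with x, v in C, then y, u are in C as well, since A is
   contained in A'. A morphism g in A' with g (y, u) nonzero makes the composite of s, g, t nonzero
   at (x, v); since g commutes with A, the composite of e, s, t cannot vanish. *)

theory Submission
  imports Defs
begin

section \<open>Quantale arithmetic\<close>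

lemma mult_bot [simp]: "x * bot = (bot :: 'q::comm_involutive_quantale)"
  using mult_Sup[of x "{}"] by simp

lemma bot_mult [simp]: "bot * x = (bot :: 'q::comm_involutive_quantale)"
  using mult_bot[of x] by (simp add: mult.commute)

lemma mult_SUP:
  "x * (SUP y\<in>Y. f y) = (SUP y\<in>Y. x * f y :: 'q::comm_involutive_quantale)"
  by (simp add: mult_Sup image_image)

lemma SUP_mult:
  "(SUP y\<in>Y. f y) * x = (SUP y\<in>Y. f y * x :: 'q::comm_involutive_quantale)"
  using mult_SUP[of x f Y] by (simp add: mult.commute)

lemma mult_sup:
  "x * sup y z = sup (x * y) (x * z :: 'q::comm_involutive_quantale)"
  using mult_Sup[of x "{y, z}"] by simp

lemma sup_mult:
  "sup y z * x = sup (y * x) (z * x :: 'q::comm_involutive_quantale)"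
  using mult_sup[of x y z] by (simp add: mult.commute)

lemma involution_bot [simp]: "involution bot = (bot :: 'q::comm_involutive_quantale)"
  using involution_Sup[of "{} :: 'q set"] by simp

lemma involution_eq_bot_iff:
  "involution x = bot \<longleftrightarrow> x = (bot :: 'q::comm_involutive_quantale)"
  by (metis involution_bot involution_involution)

lemma involution_SUP:
  "involution (SUP y\<in>Y. f y) = (SUP y\<in>Y. involution (f y) :: 'q::comm_involutive_quantale)"
  by (simp add: involution_Sup image_image)

text \<open>If \<open>1\<close> were \<open>bot\<close>, every element \<open>1 * x\<close> would be
  \<open>bot\<close>, and the quantale would collapse.\<close>

lemma one_neq_bot: "(1 :: 'q::comm_involutive_quantale) \<noteq> bot"
  by (metis bot_neq_top bot_mult mult_1)

section \<open>Composition of relations\<close>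

lemma rel_ext:
  assumes "f \<in> Hom X Y" "g \<in> Hom X Y"
    and "\<And>x y. x \<in> X \<Longrightarrow> y \<in> Y \<Longrightarrow> f (x, y) = g (x, y)"
  shows "f = g"
  using assms unfolding Hom_def by (intro PiE_ext[of f _ _ g]) auto

lemma rel_in_Hom [simp]:
  "rel_comp X Y Z g f \<in> Hom X Z" "rel_id X \<in> Hom X X" "rel_dagger X Y f' \<in> Hom Y X"
  "rel_zero X Y \<in> Hom X Y" "rel_add X Y h k \<in> Hom X Y"
  by (auto simp: Hom_def rel_comp_def rel_id_def rel_dagger_def rel_zero_def rel_add_def)

lemma rel_comp_apply:
  "x \<in> X \<Longrightarrow> z \<in> Z \<Longrightarrow> rel_comp X Y Z g f (x, z) = (SUP y\<in>Y. f (x, y) * g (y, z))"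
  by (simp add: rel_comp_def)

lemma rel_id_apply: "x \<in> X \<Longrightarrow> y \<in> X \<Longrightarrow> rel_id X (x, y) = (if x = y then 1 else bot)"
  by (simp add: rel_id_def)

lemma rel_zero_apply [simp]: "x \<in> X \<Longrightarrow> y \<in> Y \<Longrightarrow> rel_zero X Y (x, y) = bot"
  by (simp add: rel_zero_def)

lemma rel_add_apply:
  "x \<in> X \<Longrightarrow> y \<in> Y \<Longrightarrow> rel_add X Y f g (x, y) = sup (f (x, y)) (g (x, y))"
  by (simp add: rel_add_def)

lemma rel_dagger_apply:
  "y \<in> Y \<Longrightarrow> x \<in> X \<Longrightarrow> rel_dagger X Y f (y, x) = involution (f (x, y))"
  by (simp add: rel_dagger_def)

lemma rel_comp_assoc:
  "rel_comp X Y W (rel_comp Y Z W h g) f = rel_comp X Z W h (rel_comp X Y Z g f)"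
proof (rule rel_ext[of _ X W])
  fix x w assume "x \<in> X" "w \<in> W"
  have "(SUP y\<in>Y. SUP z\<in>Z. f (x, y) * (g (y, z) * h (z, w)))
      = (SUP z\<in>Z. SUP y\<in>Y. f (x, y) * (g (y, z) * h (z, w)))"
    by (rule SUP_commute)
  with \<open>x \<in> X\<close> \<open>w \<in> W\<close> show "rel_comp X Y W (rel_comp Y Z W h g) f (x, w)
      = rel_comp X Z W h (rel_comp X Y Z g f) (x, w)"
    by (simp add: rel_comp_apply mult_SUP SUP_mult mult.assoc cong: SUP_cong)
qed simp_all

lemma rel_dagger_comp:
  "rel_dagger X Z (rel_comp X Y Z g f) = rel_comp Z Y X (rel_dagger X Y f) (rel_dagger Y Z g)"
  by (rule rel_ext[of _ Z X])
    (simp_all add: rel_dagger_apply rel_comp_apply involution_SUP involution_mult cong: SUP_cong)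

lemma rel_dagger_dagger: "f \<in> Hom X Y \<Longrightarrow> rel_dagger Y X (rel_dagger X Y f) = f"
  by (rule rel_ext[of _ X Y]) (simp_all add: rel_dagger_apply involution_involution)

lemma rel_comp_zero_right: "rel_comp X Y Z g (rel_zero X Y) = rel_zero X Z"
  by (rule rel_ext[of _ X Z]) (auto simp: rel_comp_apply)

lemma rel_comp_add_right:
  "rel_comp X Y Z h (rel_add X Y f g) = rel_add X Z (rel_comp X Y Z h f) (rel_comp X Y Z h g)"
  by (rule rel_ext[of _ X Z])
    (simp_all add: rel_comp_apply rel_add_apply sup_mult
      complete_lattice_class.SUP_sup_distrib cong: SUP_cong)

text \<open>The composite at \<open>(x, z)\<close> is a join that dominates the term for the path
  through \<open>y\<close>, so a single nonzero term suffices. All uses of zero-divisor-freeness go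
  through this lemma.\<close>

lemma rel_comp_neq_bot:
  fixes f :: "'x \<times> 'y \<Rightarrow> 'q::comm_involutive_quantale"
  assumes "zero_divisor_free TYPE('q)" "x \<in> X" "y \<in> Y" "z \<in> Z"
    and "f (x, y) \<noteq> bot" "g (y, z) \<noteq> bot"
  shows "rel_comp X Y Z g f (x, z) \<noteq> bot"
proof -
  have "f (x, y) * g (y, z) \<noteq> bot"
    using assms(1,5,6) by (auto simp: zero_divisor_free_def)
  moreover have "f (x, y) * g (y, z) \<le> rel_comp X Y Z g f (x, z)"
    using assms(2-4) by (auto simp: rel_comp_apply intro: SUP_upper2)
  ultimately show ?thesis by (metis bot.extremum_uniqueI)
qed

section \<open>Diagonal indicators\<close>

definition rel_indicator :: "'x set \<Rightarrow> 'x set \<Rightarrow> 'x \<times> 'x \<Rightarrow> 'q::comm_involutive_quantale" where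
  "rel_indicator X P = (\<lambda>(x, y)\<in>X \<times> X. if x = y \<and> x \<in> P then 1 else bot)"

lemma rel_indicator_in_Hom [simp]: "rel_indicator X P \<in> Hom X X"
  by (auto simp: Hom_def rel_indicator_def)

lemma rel_indicator_apply:
  "x \<in> X \<Longrightarrow> y \<in> X \<Longrightarrow> rel_indicator X P (x, y) = (if x = y \<and> x \<in> P then 1 else bot)"
  by (simp add: rel_indicator_def)

text \<open>Only the term \<open>y = x\<close> of the join can survive. The right factor acts first,
  so an indicator on the right cuts down the source coordinate; on the left it cuts down the target
  coordinate.\<close>

lemma comp_indicator_apply:
  assumes "x \<in> X" "z \<in> X"
  shows "(f \<circ>\<^bsub>X\<^esub> rel_indicator X P) (x, z) = (if x \<in> P then f (x, z) else bot)"
proof -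
  have "(f \<circ>\<^bsub>X\<^esub> rel_indicator X P) (x, z)
      = (SUP y\<in>X. if y = x \<and> x \<in> P then f (x, z) else bot)"
    unfolding rel_comp_apply[OF assms]
    by (rule SUP_cong) (use assms in \<open>auto simp: rel_indicator_apply\<close>)
  also have "\<dots> = (if x \<in> P then f (x, z) else bot)"
    using assms by (auto intro!: antisym SUP_least SUP_upper2[of x])
  finally show ?thesis .
qed

lemma indicator_comp_apply:
  assumes "x \<in> X" "z \<in> X"
  shows "(rel_indicator X P \<circ>\<^bsub>X\<^esub> f) (x, z) = (if z \<in> P then f (x, z) else bot)"
proof -
  have "(rel_indicator X P \<circ>\<^bsub>X\<^esub> f) (x, z)
      = (SUP y\<in>X. if y = z \<and> z \<in> P then f (x, z) else bot)"
    unfolding rel_comp_apply[OF assms]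
    by (rule SUP_cong) (use assms in \<open>auto simp: rel_indicator_apply\<close>)
  also have "\<dots> = (if z \<in> P then f (x, z) else bot)"
    using assms by (auto intro!: antisym SUP_least SUP_upper2[of z])
  finally show ?thesis .
qed

lemma rel_indicator_neqI:
  assumes "x \<in> X" "x \<in> P" "x \<notin> R"
  shows "rel_indicator X P \<noteq> (rel_indicator X R :: _ \<Rightarrow> 'q::comm_involutive_quantale)"
proof
  assume "rel_indicator X P = (rel_indicator X R :: _ \<Rightarrow> 'q)"
  then have "rel_indicator X P (x, x) = (rel_indicator X R (x, x) :: 'q)" by simp
  with assms show False by (simp add: rel_indicator_apply one_neq_bot)
qed

lemma rel_zero_eq_indicator: "\<zero>\<^bsub>X\<^esub> = rel_indicator X {}"
  by (rule rel_ext[of _ X X]) (simp_all add: rel_indicator_apply)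

text \<open>Off the diagonal a join equal to \<open>bot\<close> forces both summands to vanish. On
  the diagonal, orthogonality to the complement \<open>q\<close> lets at most one of
  \<open>p (x, x)\<close> and \<open>q (x, x)\<close> be nonzero, and since their join is
  \<open>1\<close>, that one equals \<open>1\<close>.\<close>

lemma subunital_idempotent_is_indicator:
  fixes A :: "('x \<times> 'x \<Rightarrow> 'q::comm_involutive_quantale) set"
  assumes zdf: "zero_divisor_free TYPE('q)" and "A \<subseteq> Hom X X"
    and p: "p \<in> subunital_idempotents X A"
  obtains P where "P \<subseteq> X" "p = rel_indicator X P"
proof
  obtain q where pq: "p \<circ>\<^bsub>X\<^esub> q = \<zero>\<^bsub>X\<^esub>" "p +\<^bsub>X\<^esub> q = rel_id X"
    using p by (auto simp: subunital_idempotents_def)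
  have sum: "sup (p (x, y)) (q (x, y)) = (if x = y then 1 else bot)"
    if "x \<in> X" "y \<in> X" for x y
    using that pq(2) by (metis rel_add_apply rel_id_apply)
  show "{x \<in> X. p (x, x) \<noteq> bot} \<subseteq> X" by auto
  show "p = rel_indicator X {x \<in> X. p (x, x) \<noteq> bot}"
  proof (rule rel_ext[of _ X X])
    show "p \<in> Hom X X" using assms by (auto simp: subunital_idempotents_def)
  next
    fix x y assume xy: "x \<in> X" "y \<in> X"
    show "p (x, y) = rel_indicator X {x \<in> X. p (x, x) \<noteq> bot} (x, y)"
    proof (cases "x = y \<and> p (x, x) \<noteq> bot")
      case True
      \<comment> \<open>Otherwise the path from \<open>x\<close> to \<open>x\<close> to
        \<open>x\<close>, first along \<open>q\<close> and then along \<open>p\<close>, would make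
        \<open>p \<circ> q\<close> nonzero.\<close>
      have "q (x, x) = bot"
        using rel_comp_neq_bot[OF zdf, of x X x X x X q p] True xy pq(1) by fastforce
      then show ?thesis using sum[of x x] True xy by (simp add: rel_indicator_apply)
    next
      case False
      then have "p (x, y) = bot" using sum[OF xy] by (auto split: if_splits)
      then show ?thesis using False xy by (auto simp: rel_indicator_apply)
    qed
  qed simp
qed

section \<open>Commutants and saturated sets\<close>

lemma commutant_commutes: "f \<in> A \<Longrightarrow> g \<in> commutant X A \<Longrightarrow> g \<circ>\<^bsub>X\<^esub> f = f \<circ>\<^bsub>X\<^esub> g"
  by (simp add: commutant_def)

lemma commutant_comp:
  assumes g: "g \<in> commutant X A" and h: "h \<in> commutant X A"
  shows "h \<circ>\<^bsub>X\<^esub> g \<in> commutant X A"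
proof -
  have "(h \<circ>\<^bsub>X\<^esub> g) \<circ>\<^bsub>X\<^esub> f = f \<circ>\<^bsub>X\<^esub> (h \<circ>\<^bsub>X\<^esub> g)" if "f \<in> A" for f
    using commutant_commutes[OF that g] commutant_commutes[OF that h]
    by (metis rel_comp_assoc)
  then show ?thesis by (simp add: commutant_def)
qed

text \<open>Apply the dagger to the commutation of \<open>g\<close> with the dagger of
  \<open>f\<close>, which again lies in \<open>A\<close>. This makes the relation given by nonzero
  entries of the commutant symmetric.\<close>

lemma commutant_dagger:
  assumes A: "A \<subseteq> Hom X X" "\<And>f. f \<in> A \<Longrightarrow> rel_dagger X X f \<in> A"
    and g: "g \<in> commutant X A"
  shows "rel_dagger X X g \<in> commutant X A"
proof -
  have "rel_dagger X X g \<circ>\<^bsub>X\<^esub> f = f \<circ>\<^bsub>X\<^esub> rel_dagger X X g" if "f \<in> A" for f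
  proof -
    have "rel_dagger X X (g \<circ>\<^bsub>X\<^esub> rel_dagger X X f) = rel_dagger X X (rel_dagger X X f \<circ>\<^bsub>X\<^esub> g)"
      using commutant_commutes[OF A(2)[OF that] g] by simp
    moreover have "rel_dagger X X (rel_dagger X X f) = f"
      using A(1) that by (auto intro: rel_dagger_dagger)
    ultimately show ?thesis by (simp add: rel_dagger_comp)
  qed
  then show ?thesis by (simp add: commutant_def)
qed

lemma rel_id_comp: "f \<in> Hom X X \<Longrightarrow> rel_id X \<circ>\<^bsub>X\<^esub> f = f"
  and rel_comp_id: "f \<in> Hom X X \<Longrightarrow> f \<circ>\<^bsub>X\<^esub> rel_id X = f"
proof -
  have id: "rel_id X = (rel_indicator X X :: _ \<Rightarrow> 'q::comm_involutive_quantale)" for X :: "'x set"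
    by (rule rel_ext[of _ X X]) (simp_all add: rel_id_apply rel_indicator_apply)
  show "f \<in> Hom X X \<Longrightarrow> rel_id X \<circ>\<^bsub>X\<^esub> f = f" "f \<in> Hom X X \<Longrightarrow> f \<circ>\<^bsub>X\<^esub> rel_id X = f"
    by (rule rel_ext[of _ X X]; simp add: id indicator_comp_apply comp_indicator_apply)+
qed

lemma rel_id_in_commutant: "A \<subseteq> Hom X X \<Longrightarrow> rel_id X \<in> commutant X A"
  by (auto simp: commutant_def rel_id_comp rel_comp_id)

text \<open>Take the graph on \<open>X\<close> whose edges are the nonzero entries of members of
  \<open>B\<close>, with directions ignored: the part of \<open>P\<close> inside \<open>X\<close> is
  a union of its connected components.\<close>

definition saturated :: "'x set \<Rightarrow> ('x \<times> 'x \<Rightarrow> 'q::comm_involutive_quantale) set \<Rightarrow> 'x set \<Rightarrow> bool"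
  where "saturated X B P \<longleftrightarrow>
    (\<forall>g\<in>B. \<forall>x\<in>X. \<forall>y\<in>X. g (x, y) \<noteq> bot \<longrightarrow> (x \<in> P \<longleftrightarrow> y \<in> P))"

lemma saturatedD:
  "saturated X B P \<Longrightarrow> g \<in> B \<Longrightarrow> x \<in> X \<Longrightarrow> y \<in> X \<Longrightarrow> g (x, y) \<noteq> bot \<Longrightarrow> x \<in> P \<longleftrightarrow> y \<in> P"
  by (auto simp: saturated_def)

lemma saturated_Diff: "saturated X B P \<Longrightarrow> saturated X B R \<Longrightarrow> saturated X B (P - R)"
  unfolding saturated_def by blast

lemma saturated_space: "saturated X B X"
  by (auto simp: saturated_def)

text \<open>At \<open>(x, y)\<close> the two composites are \<open>g (x, y)\<close> cut down by
  \<open>y \<in> P\<close> and by \<open>x \<in> P\<close> respectively. They agree exactly when the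
  entry vanishes or \<open>P\<close> does not separate \<open>x\<close> from
  \<open>y\<close>.\<close>

lemma indicator_in_commutant_iff: "rel_indicator X P \<in> commutant X B \<longleftrightarrow> saturated X B P"
proof
  assume ind: "rel_indicator X P \<in> commutant X B"
  show "saturated X B P"
    unfolding saturated_def
  proof (intro ballI impI)
    fix g x y assume gxy: "g \<in> B" "x \<in> X" "y \<in> X" "g (x, y) \<noteq> bot"
    have "(rel_indicator X P \<circ>\<^bsub>X\<^esub> g) (x, y) = (g \<circ>\<^bsub>X\<^esub> rel_indicator X P) (x, y)"
      using ind gxy(1) by (simp add: commutant_commutes)
    then show "x \<in> P \<longleftrightarrow> y \<in> P"
      using gxy by (simp add: indicator_comp_apply comp_indicator_apply split: if_splits)
  qed
next
  assume sat: "saturated X B P"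
  have "rel_indicator X P \<circ>\<^bsub>X\<^esub> g = g \<circ>\<^bsub>X\<^esub> rel_indicator X P" if "g \<in> B" for g
    using saturatedD[OF sat that]
    by (intro rel_ext[of _ X X]) (simp_all add: indicator_comp_apply comp_indicator_apply, metis)
  then show "rel_indicator X P \<in> commutant X B" by (simp add: commutant_def)
qed

text \<open>The set is the class of \<open>x\<close>. Closure of the commutant under composition
  extends it along an entry, and closure under the dagger extends it against one.\<close>

lemma saturated_class:
  fixes A :: "('x \<times> 'x \<Rightarrow> 'q::comm_involutive_quantale) set"
  assumes zdf: "zero_divisor_free TYPE('q)"
    and A: "A \<subseteq> Hom X X" "\<And>f. f \<in> A \<Longrightarrow> rel_dagger X X f \<in> A"
    and "x \<in> X"
  shows "saturated X (commutant X A) {y \<in> X. \<exists>g\<in>commutant X A. g (x, y) \<noteq> bot}"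
    (is "saturated X ?B ?C")
proof -
  have step: "z \<in> ?C" if "y \<in> ?C" "z \<in> X" "h \<in> ?B" "h (y, z) \<noteq> bot" for h y z
  proof -
    from \<open>y \<in> ?C\<close> obtain g where "y \<in> X" "g \<in> ?B" "g (x, y) \<noteq> bot" by auto
    then have "h \<circ>\<^bsub>X\<^esub> g \<in> ?B" "(h \<circ>\<^bsub>X\<^esub> g) (x, z) \<noteq> bot"
      using commutant_comp that(3) 
        rel_comp_neq_bot[where f = g and g = h and y = y, OF zdf \<open>x \<in> X\<close> _ that(2) _ that(4)]
      by auto
    with \<open>z \<in> X\<close> show ?thesis by blast
  qed
  \<comment> \<open>A backward step along \<open>h\<close> is a forward step along its
    dagger.\<close>
  have "y \<in> ?C" if "z \<in> ?C" "y \<in> X" "h \<in> ?B" "h (y, z) \<noteq> bot" for h y z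
  proof (rule step)
    show "rel_dagger X X h (z, y) \<noteq> bot"
      using that by (simp add: rel_dagger_apply involution_eq_bot_iff)
  qed (use that commutant_dagger[OF A] in auto)
  with step show ?thesis unfolding saturated_def by blast
qed

section \<open>Primitive idempotents\<close>

text \<open>The complement of a saturated set is saturated too, so its indicator also lies in
  \<open>A\<close> and serves as the complementary idempotent. The double commutant property allows
  \<open>B\<close> to be the commutant of \<open>A\<close>.\<close>

lemma indicator_subunital_iff:
  assumes "A = commutant X B" "P \<subseteq> X"
  shows "rel_indicator X P \<in> subunital_idempotents X A \<longleftrightarrow> saturated X B P"
proof
  assume "rel_indicator X P \<in> subunital_idempotents X A"
  then show "saturated X B P"
    using assms by (simp add: subunital_idempotents_def indicator_in_commutant_iff)
next
  assume sat: "saturated X B P"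
  have idem: "rel_indicator X R \<circ>\<^bsub>X\<^esub> rel_indicator X R = rel_indicator X R" for R
    by (rule rel_ext[of _ X X]) (auto simp: comp_indicator_apply rel_indicator_apply)
  have "rel_indicator X P \<circ>\<^bsub>X\<^esub> rel_indicator X (X - P) = \<zero>\<^bsub>X\<^esub>"
    by (rule rel_ext[of _ X X]) (auto simp: comp_indicator_apply rel_indicator_apply)
  moreover have "rel_indicator X P +\<^bsub>X\<^esub> rel_indicator X (X - P) = rel_id X"
    by (rule rel_ext[of _ X X]) (auto simp: rel_add_apply rel_indicator_apply rel_id_apply)
  moreover have "rel_indicator X P \<in> A" "rel_indicator X (X - P) \<in> A"
    using sat assms by (simp_all add: indicator_in_commutant_iff saturated_Diff saturated_space)
  ultimately show "rel_indicator X P \<in> subunital_idempotents X A"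
    using idem by (auto simp: subunital_idempotents_def)
qed

text \<open>If \<open>y\<close> were outside the class \<open>C\<close> of \<open>x\<close>, the
  indicators of \<open>C\<close> and \<open>P - C\<close> would split the idempotent into two
  non-trivial summands.\<close>

lemma primitive_idempotent_connected:
  fixes A :: "('x \<times> 'x \<Rightarrow> 'q::comm_involutive_quantale) set"
  assumes zdf: "zero_divisor_free TYPE('q)"
    and A: "A \<subseteq> Hom X X" "\<And>f. f \<in> A \<Longrightarrow> rel_dagger X X f \<in> A"
    and vN: "A = commutant X (commutant X A)"
    and prim: "rel_indicator X P \<in> primitive_idempotents X A"
    and P: "P \<subseteq> X" "x \<in> P" "y \<in> P"
  shows "\<exists>g\<in>commutant X A. g (x, y) \<noteq> bot"
proof (rule ccontr)
  define C where "C = {z \<in> X. \<exists>g\<in>commutant X A. g (x, z) \<noteq> bot}"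
  let ?i = "rel_indicator X :: 'x set \<Rightarrow> 'x \<times> 'x \<Rightarrow> 'q"
  assume "\<not> (\<exists>g\<in>commutant X A. g (x, y) \<noteq> bot)"
  then have y: "y \<notin> C" by (simp add: C_def)
  have x: "x \<in> C"
    using rel_id_in_commutant[OF A(1)] P one_neq_bot
    by (auto intro!: bexI[of _ "rel_id X"] simp: C_def rel_id_apply)
  have satP: "saturated X (commutant X A) P"
    using prim indicator_subunital_iff[OF vN P(1)] by (simp add: primitive_idempotents_def)
  have satC: "saturated X (commutant X A) C"
    unfolding C_def using saturated_class[OF zdf A] P by blast
  have "C \<subseteq> P"
    unfolding C_def using saturatedD[OF satP] P by blast
  have sum: "?i P = ?i C +\<^bsub>X\<^esub> ?i (P - C)"
    using \<open>C \<subseteq> P\<close> by (intro rel_ext[of _ X X]) (auto simp: rel_add_apply rel_indicator_apply)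
  have sub: "?i C \<in> subunital_idempotents X A" "?i (P - C) \<in> subunital_idempotents X A"
    using indicator_subunital_iff[OF vN, of C] indicator_subunital_iff[OF vN, of "P - C"]
      satC saturated_Diff[OF satP satC] \<open>C \<subseteq> P\<close> P(1) by auto
  have neq: "?i R \<noteq> ?i S" if "z \<in> P" "z \<in> R" "z \<notin> S" for R S z
    using that P(1) by (intro rel_indicator_neqI[of z]) auto
  \<comment> \<open>The point \<open>x\<close> lies in \<open>P\<close> and \<open>C\<close> but not
    in \<open>P - C\<close>; below, \<open>y\<close> lies in \<open>P\<close> and
    \<open>P - C\<close> but not in \<open>C\<close>. These two points witness all four
    inequalities.\<close>
  have "?i C \<noteq> ?i {}" "?i P \<noteq> ?i (P - C)"
    using x P(2) neq[of x] by blast+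
  moreover have "?i (P - C) \<noteq> ?i {}" "?i P \<noteq> ?i C"
    using y P(3) neq[of y] by blast+
  ultimately have "?i C \<notin> {\<zero>\<^bsub>X\<^esub>, ?i P}" "?i (P - C) \<notin> {\<zero>\<^bsub>X\<^esub>, ?i P}"
    unfolding rel_zero_eq_indicator by (metis insert_iff empty_iff)+
  moreover have "\<not> (\<exists>q\<in>subunital_idempotents X A. \<exists>r\<in>subunital_idempotents X A.
      q \<notin> {\<zero>\<^bsub>X\<^esub>, ?i P} \<and> r \<notin> {\<zero>\<^bsub>X\<^esub>, ?i P} \<and> ?i P = q +\<^bsub>X\<^esub> r)"
    using prim by (simp only: primitive_idempotents_def mem_Collect_eq simp_thms)
  ultimately show False using sum sub by blast
qed

section \<open>The complement of a component\<close>

text \<open>By commutativity \<open>p\<close> can be moved past \<open>s\<close> to meet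
  \<open>t\<close>, which gives absorption; distributivity gives closure under sums.\<close>

lemma annihilator_is_ideal:
  assumes A: "\<zero>\<^bsub>X\<^esub> \<in> A" "\<And>f g. f \<in> A \<Longrightarrow> g \<in> A \<Longrightarrow> f +\<^bsub>X\<^esub> g \<in> A"
      "\<And>f g. f \<in> A \<Longrightarrow> g \<in> A \<Longrightarrow> g \<circ>\<^bsub>X\<^esub> f \<in> A"
      "\<And>f g. f \<in> A \<Longrightarrow> g \<in> A \<Longrightarrow> f \<circ>\<^bsub>X\<^esub> g = g \<circ>\<^bsub>X\<^esub> f"
    and "p \<in> A"
  shows "is_ideal X A {f \<in> A. p \<circ>\<^bsub>X\<^esub> f = \<zero>\<^bsub>X\<^esub>}"
proof -
  have "p \<circ>\<^bsub>X\<^esub> (s \<circ>\<^bsub>X\<^esub> t) = \<zero>\<^bsub>X\<^esub>" if "s \<in> A" "p \<circ>\<^bsub>X\<^esub> t = \<zero>\<^bsub>X\<^esub>" for s t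
    using that A(4)[OF \<open>p \<in> A\<close> \<open>s \<in> A\<close>] by (metis rel_comp_assoc rel_comp_zero_right)
  moreover have "\<zero>\<^bsub>X\<^esub> +\<^bsub>X\<^esub> \<zero>\<^bsub>X\<^esub> = \<zero>\<^bsub>X\<^esub>"
    by (rule rel_ext[of _ X X]) (simp_all add: rel_add_apply)
  ultimately show ?thesis
    using A by (auto simp: is_ideal_def rel_comp_zero_right rel_comp_add_right)
qed

text \<open>An indicator on the left keeps only entries with target in \<open>P\<close>, so this
  gives control of \<open>y\<close> but not of \<open>x\<close>.\<close>

lemma nonzero_entry:
  assumes "rel_indicator X P \<circ>\<^bsub>X\<^esub> f \<noteq> \<zero>\<^bsub>X\<^esub>"
  obtains x y where "x \<in> X" "y \<in> X" "y \<in> P" "f (x, y) \<noteq> bot"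
proof -
  have "\<exists>x\<in>X. \<exists>y\<in>X. (rel_indicator X P \<circ>\<^bsub>X\<^esub> f) (x, y) \<noteq> bot"
  proof (rule ccontr)
    assume "\<not> ?thesis"
    then have "rel_indicator X P \<circ>\<^bsub>X\<^esub> f = \<zero>\<^bsub>X\<^esub>" by (intro rel_ext[of _ X X]) auto
    with assms show False by simp
  qed
  then show thesis using that by (auto simp: indicator_comp_apply split: if_splits)
qed

theorem theorem27:
  fixes X :: "'x set"
    and A :: "('x \<times> 'x \<Rightarrow> 'q::comm_involutive_quantale) set"
    and I :: "'i set"
    and e :: "'i \<Rightarrow> 'x \<times> 'x \<Rightarrow> 'q"
    and a :: 'i
  assumes "zero_divisor_free TYPE('q)"
    and "comm_vN_algebra X A"
    and "bij_betw e I (primitive_idempotents X A)"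
    and "a \<in> I"
  shows "is_prime_ideal X A (component_complement X I e A a)"
proof -
  let ?B = "commutant X A"
  have A: "A \<subseteq> Hom X X" "\<zero>\<^bsub>X\<^esub> \<in> A" "\<And>f g. f \<in> A \<Longrightarrow> g \<in> A \<Longrightarrow> f +\<^bsub>X\<^esub> g \<in> A"
      "\<And>f g. f \<in> A \<Longrightarrow> g \<in> A \<Longrightarrow> g \<circ>\<^bsub>X\<^esub> f \<in> A" "\<And>f. f \<in> A \<Longrightarrow> rel_dagger X X f \<in> A"
      "\<And>f g. f \<in> A \<Longrightarrow> g \<in> A \<Longrightarrow> f \<circ>\<^bsub>X\<^esub> g = g \<circ>\<^bsub>X\<^esub> f"
    and vN: "A = commutant X ?B"
    using assms(2) unfolding comm_vN_algebra_def by blast+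
  have "A \<subseteq> ?B" using A(1,6) by (auto simp: commutant_def)
  have prim: "e a \<in> primitive_idempotents X A"
    using assms(3,4) by (auto simp: bij_betw_def)
  then have sub: "e a \<in> subunital_idempotents X A" by (simp add: primitive_idempotents_def)
  then have "e a \<in> A" by (simp add: subunital_idempotents_def)
  obtain P where P: "P \<subseteq> X" and ea: "e a = rel_indicator X P"
    using subunital_idempotent_is_indicator[OF assms(1) A(1) sub] .
  have sat: "saturated X ?B P" using sub ea indicator_subunital_iff[OF vN P] by simp
  have "e a \<circ>\<^bsub>X\<^esub> s = \<zero>\<^bsub>X\<^esub> \<or> e a \<circ>\<^bsub>X\<^esub> t = \<zero>\<^bsub>X\<^esub>"
    if s: "s \<in> A" and t: "t \<in> A" and st: "e a \<circ>\<^bsub>X\<^esub> (s \<circ>\<^bsub>X\<^esub> t) = \<zero>\<^bsub>X\<^esub>" for s t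
  proof (rule ccontr)
    assume "\<not> ?thesis"
    then obtain x y u v where xy: "x \<in> X" "y \<in> X" "y \<in> P" "s (x, y) \<noteq> bot"
      and uv: "u \<in> X" "v \<in> X" "v \<in> P" "t (u, v) \<noteq> bot"
      unfolding ea by (metis nonzero_entry)
    \<comment> \<open>Commutativity puts \<open>s\<close> in the commutant, so its nonzero entries
      cannot cross the boundary of \<open>P\<close>; this transfers membership from the target
      \<open>y\<close> to the source \<open>x\<close>.\<close>
    have "x \<in> P" using saturatedD[OF sat, of s x y] \<open>A \<subseteq> ?B\<close> s xy by auto
    \<comment> \<open>The bridge \<open>g\<close> joins the end \<open>v\<close> of the entry of
      \<open>t\<close> to the start \<open>x\<close> of the entry of \<open>s\<close>. With
      \<open>t\<close> acting first, the path runs from \<open>u\<close> through \<open>v\<close>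
      and \<open>x\<close> to \<open>y\<close>.\<close>
    then obtain g where g: "g \<in> ?B" "g (v, x) \<noteq> bot"
      using primitive_idempotent_connected[OF assms(1) A(1,5) vN] prim P uv(3) ea by metis
    have "(g \<circ>\<^bsub>X\<^esub> t) (u, x) \<noteq> bot"
      using rel_comp_neq_bot[OF assms(1)] g(2) uv xy(1) by metis
    then have "(s \<circ>\<^bsub>X\<^esub> (g \<circ>\<^bsub>X\<^esub> t)) (u, y) \<noteq> bot"
      using rel_comp_neq_bot[OF assms(1)] xy uv(1) by metis
    then have "(e a \<circ>\<^bsub>X\<^esub> (s \<circ>\<^bsub>X\<^esub> (g \<circ>\<^bsub>X\<^esub> t))) (u, y) \<noteq> bot"
      using xy uv by (simp add: ea indicator_comp_apply)
    \<comment> \<open>Moving \<open>g\<close> leftwards past \<open>s\<close> and \<open>e a\<close>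
      isolates the product assumed to be zero.\<close>
    moreover have "e a \<circ>\<^bsub>X\<^esub> (s \<circ>\<^bsub>X\<^esub> (g \<circ>\<^bsub>X\<^esub> t)) = g \<circ>\<^bsub>X\<^esub> (e a \<circ>\<^bsub>X\<^esub> (s \<circ>\<^bsub>X\<^esub> t))"
      using commutant_commutes[OF s g(1)] commutant_commutes[OF \<open>e a \<in> A\<close> g(1)]
      by (metis rel_comp_assoc)
    ultimately show False using st xy uv by (simp add: rel_comp_zero_right)
  qed
  moreover have "is_ideal X A {f \<in> A. e a \<circ>\<^bsub>X\<^esub> f = \<zero>\<^bsub>X\<^esub>}"
    using A \<open>e a \<in> A\<close> by (intro annihilator_is_ideal) auto
  \<comment> \<open>Seen inside \<open>A\<close>, the product of the other components is the
    annihilator of \<open>e a\<close>, so the two facts just shown are its primeness and its ideal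
    property.\<close>
  ultimately show ?thesis
    unfolding is_prime_ideal_def component_complement_eq[OF assms(4)] by blast
qed

end
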